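(* Let $b,c\in\mathbb{R}$ with $b\neq0$, $c\neq 0$, let $s\ge 0$ be an integer, set $d=b(s+4)$, and consider the planar system $$\dot x = y,\qquad \dot y = \frac{d}{2}y-\frac{3}{2}bx-cx^{2}.$$ In the chart $U_2$ of its Poincaré compactification the system is $$\dot u = v-\frac{duv}{2}+\frac{3}{2}bu^{2}v+cu^{3},\qquad \dot v = -\frac{dv^{2}}{2}+\frac{3}{2}buv^{2}+cu^{2}v,$$ and the critical point $(u,v)=(0,0)$ of this system is a node, stable if $c<0$ and unstable if $c>0$.
   Context: For a polynomial vector field $\dot x=P(x,y)$, $\dot y=Q(x,y)$ of degree $n$, its expression in the chart $U_2$ of the Poincaré compactification (coordinates $u=x/y$, $v=1/y$, with the points at infinity given by $v=0$) is $\dot u=v^{n}\left[P\left(\frac uv,\frac1v\right)-uQ\left(\frac uv,\frac1v\right)\right]$, $\dot v=-v^{n+1}Q\left(\frac uv,\frac1v\right)$. A (possibly non-hyperbolic) isolated critical point is a stable (attracting) node if every orbit starting sufficiently close to it tends to it as $t\to+\infty$ with a definite limiting tangent direction; it is an unstable (repelling) node if the same holds as $t\to-\infty$. *)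

theory Defs
  imports "HOL-Analysis.Analysis"
begin

definition poly_fun_deg_le :: "nat \<Rightarrow> (real \<times> real \<Rightarrow> real) \<Rightarrow> bool" where
  "poly_fun_deg_le n p \<longleftrightarrow>
     (\<exists>a :: nat \<Rightarrow> nat \<Rightarrow> real. \<forall>x y. p (x, y) = (\<Sum>i\<le>n. \<Sum>j\<le>n - i. a i j * x ^ i * y ^ j))"

text \<open>Meaningful for polynomial vector fields only.\<close>

definition vf_degree :: "(real \<times> real \<Rightarrow> real \<times> real) \<Rightarrow> nat" where
  "vf_degree X =
     (LEAST n. poly_fun_deg_le n (\<lambda>z. fst (X z)) \<and> poly_fun_deg_le n (\<lambda>z. snd (X z)))"

text \<open>
  The field \<open>G\<close> is the expression of the polynomial field \<open>X = (P, Q)\<close> in the chart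
  \<open>U\<^sub>2\<close>, with \<open>u = x / y\<close> and \<open>v = 1 / y\<close>. The defining formulas make
  sense only for \<open>v \<noteq> 0\<close>; at infinity (\<open>v = 0\<close>) the field is their polynomial
  extension, which is unique by \<open>U2_expression_unique\<close> below.
\<close>

definition U2_expression ::
  "(real \<times> real \<Rightarrow> real \<times> real) \<Rightarrow> (real \<times> real \<Rightarrow> real \<times> real) \<Rightarrow> bool" where
  "U2_expression X G \<longleftrightarrow>
     polynomial_function X \<and> polynomial_function G \<and>
     (\<forall>u v. v \<noteq> 0 \<longrightarrow>
        (let n = vf_degree X; P = fst (X (u / v, 1 / v)); Q = snd (X (u / v, 1 / v))
         in G (u, v) = (v ^ n * (P - u * Q), - (v ^ (n + 1)) * Q)))"

lemma U2_expression_unique: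
  assumes "U2_expression X G" "U2_expression X H"
  shows "G = H"
proof
  fix z :: "real \<times> real"
  obtain u v where z: "z = (u, v)" by (cases z)
  have off: "G (u, w) = H (u, w)" if "w \<noteq> 0" for w
    using assms that by (simp add: U2_expression_def Let_def)
  have cont: "isCont (\<lambda>w. K (u, w)) v" if "polynomial_function K"
    for K :: "real \<times> real \<Rightarrow> real \<times> real"
  proof -
    have "isCont K (u, v)"
      using that by (simp add: continuous_polymonial_function)
    then show ?thesis
      using continuous_at_compose[of v "\<lambda>w. (u, w)" K] by (simp add: o_def)
  qed
  have limG: "((\<lambda>w. G (u, w)) \<longlongrightarrow> G (u, v)) (at v)"
    and limH: "((\<lambda>w. H (u, w)) \<longlongrightarrow> H (u, v)) (at v)"
    using assms cont by (simp_all add: U2_expression_def isCont_def)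
  have "\<forall>\<^sub>F w in at v. w \<noteq> 0"
    by (rule eventually_neq_at_within)
  then have "\<forall>\<^sub>F w in at v. G (u, w) = H (u, w)"
    by eventually_elim (rule off)
  from Lim_transform_eventually[OF limG this] limH have "G (u, v) = H (u, v)"
    by (rule tendsto_unique[OF trivial_limit_at])
  then show "G z = H z" by (simp add: z)
qed

definition solves_ode_on ::
  "(real \<times> real \<Rightarrow> real \<times> real) \<Rightarrow> real set \<Rightarrow> (real \<Rightarrow> real \<times> real) \<Rightarrow> bool" where
  "solves_ode_on F T x \<longleftrightarrow> (\<forall>t\<in>T. (x has_vector_derivative F (x t)) (at t within T))"

text \<open>
  The limiting tangent direction of an orbit at \<open>p\<close> is the limit of the unit vectors pointing
  from \<open>p\<close> to the moving point; as \<open>sgn 0 = 0\<close>, the condition \<open>norm w = 1\<close>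
  makes it meaningful. The constant orbit at \<open>p\<close> itself has no direction.
\<close>

definition tends_with_tangent ::
  "(real \<Rightarrow> real \<times> real) \<Rightarrow> real \<times> real \<Rightarrow> real filter \<Rightarrow> bool" where
  "tends_with_tangent x p L \<longleftrightarrow>
     (x \<longlongrightarrow> p) L \<and> (\<exists>w. norm w = 1 \<and> ((\<lambda>t. sgn (x t - p)) \<longlongrightarrow> w) L)"

text \<open>
  Here \<open>T\<close> is the time half-line. The existence of a solution on all of \<open>T\<close> is part of
  the condition, so that orbits escaping in finite time are not ignored.
\<close>

definition nearby_orbits_tend ::
  "(real \<times> real \<Rightarrow> real \<times> real) \<Rightarrow> real \<times> real \<Rightarrow> real set \<Rightarrow> real filter \<Rightarrow> bool" where
  "nearby_orbits_tend F p T L \<longleftrightarrow>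
     (\<exists>\<delta>>0. \<forall>q. q \<noteq> p \<and> dist q p < \<delta> \<longrightarrow>
        (\<exists>x. solves_ode_on F T x \<and> x 0 = q) \<and>
        (\<forall>x. solves_ode_on F T x \<and> x 0 = q \<longrightarrow> tends_with_tangent x p L))"

definition stable_node :: "(real \<times> real \<Rightarrow> real \<times> real) \<Rightarrow> real \<times> real \<Rightarrow> bool" where
  "stable_node F p \<longleftrightarrow> p isolated_in {z. F z = 0} \<and> nearby_orbits_tend F p {0..} at_top"

definition unstable_node :: "(real \<times> real \<Rightarrow> real \<times> real) \<Rightarrow> real \<times> real \<Rightarrow> bool" where
  "unstable_node F p \<longleftrightarrow> p isolated_in {z. F z = 0} \<and> nearby_orbits_tend F p {..0} at_bot"

end

theory Submission
  imports Defs
begin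

text \<open>
  The field is \<open>(v, 0) + R (u, v)\<close> with \<open>R = - d v / 2 + 3 b u v / 2 + c u\<^sup>2\<close>, so off the
  invariant axis \<open>v = 0\<close> the quotient \<open>x = u / v\<close> satisfies \<open>x' = 1\<close>, and \<open>y = 1 / v\<close> satisfies
  the scalar Abel equation \<open>y' = d / 2 + q(x) / y\<close> with \<open>q(x) = - c x\<^sup>2 - 3 b x / 2\<close>. Let \<open>c < 0\<close>
  and, by the symmetry \<open>(u, v, d) \<mapsto> (- u, - v, - d)\<close>, let \<open>y > 0\<close>. Close to the origin \<open>y\<close> is
  large compared with \<open>x\<close>, which keeps \<open>y\<close> away from \<open>0\<close> until the quadratic growth of \<open>q\<close> takes
  over; so the solution is global. The growth of \<open>q\<close> also forces \<open>y\<close> to grow at least like \<open>x\<close> to the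
  power \<open>3/2\<close>, hence \<open>u = x / y\<close> tends to \<open>0\<close>, and as \<open>v / u = 1 / x\<close> tends to \<open>0\<close> too, the orbit
  is tangent to the \<open>u\<close>-axis. On the axis the equation is \<open>u' = c u\<^sup>3\<close>. The case \<open>c > 0\<close> follows by
  reversing time and \<open>v\<close>.
\<close>

section \<open>Global solutions and barriers\<close>

text \<open>A derivative at \<open>t\<close> only sees a neighbourhood of \<open>t\<close>, so the
  fundamental theorem on the compact interval up to \<open>t + 1\<close> decides it.\<close>

lemma integral_has_vector_derivative_at_least:
  fixes g :: "real \<Rightarrow> 'a::banach"
  assumes "continuous_on {0..} g" "t \<ge> 0"
  shows "((\<lambda>u. integral {0..u} g) has_vector_derivative g t) (at t within {0..})"
proof -
  have "((\<lambda>u. integral {0..u} g) has_vector_derivative g t) (at t within {0..t + 1})"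
    using assms by (intro integral_has_vector_derivative continuous_on_subset[OF assms(1)]) auto
  moreover have "at t within {0..t + 1} = at t within {0..}"
    using assms(2) by (intro at_within_nhd[of t "{..<t + 1}"]) auto
  ultimately show ?thesis by simp
qed

text \<open>A Lipschitz constant that depends on time excludes blow-up. Banach's fixed point theorem
  in one suitably weighted space yields the solution on the entire half-line at once, without gluing
  local solutions.\<close>

lemma global_Lipschitz_ODE_solution:
  fixes F :: "real \<Rightarrow> 'a::banach \<Rightarrow> 'a" and L :: "real \<Rightarrow> real"
  assumes F: "continuous_on ({0..} \<times> UNIV) (\<lambda>(t, y). F t y)"
    and L: "continuous_on {0..} L"
    and Lip: "\<And>t y z. t \<ge> 0 \<Longrightarrow> norm (F t y - F t z) \<le> L t * norm (y - z)"
  obtains y where "y 0 = y0"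
    and "\<And>t. t \<ge> 0 \<Longrightarrow> (y has_vector_derivative F t (y t)) (at t within {0..})"
proof -
  have contF: "continuous_on {0..} (\<lambda>s. F s (\<phi> s))" if "continuous_on {0..} \<phi>" for \<phi>
  proof -
    have "continuous_on {0..} (\<lambda>s. (\<lambda>(t, y). F t y) (s, \<phi> s))"
      by (rule continuous_on_compose2[OF F]) (auto intro!: continuous_intros that)
    then show ?thesis by simp
  qed
  \<comment> \<open>Each summand has one task: \<open>2 * \<bar>L s\<bar>\<close> gives the
    contraction factor \<open>1/2\<close>, \<open>norm (F s 0)\<close> keeps the images of the
    operator bounded, and \<open>1\<close> makes \<open>\<mu>\<close> positive.\<close>
  define \<mu> where "\<mu> s = 2 * \<bar>L s\<bar> + norm (F s 0) + 1" for s
  define M where "M t = integral {0..t} \<mu>" for t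
  have contmu: "continuous_on {0..} \<mu>"
    unfolding \<mu>_def by (intro continuous_intros L contF)
  have M': "(M has_vector_derivative \<mu> t) (at t within {0..})" if "t \<ge> 0" for t
    unfolding M_def using integral_has_vector_derivative_at_least[OF contmu that] .
  have contM: "continuous_on {0..} M"
    using M' by (auto simp: continuous_on_eq_continuous_within intro: has_vector_derivative_continuous)
  have M0: "M 0 = 0" by (simp add: M_def)
  have M_nonneg: "M t \<ge> 0" if "t \<ge> 0" for t
    unfolding M_def by (rule integral_nonneg)
      (auto simp: \<mu>_def intro!: integrable_continuous_interval continuous_on_subset[OF contmu, unfolded \<mu>_def])
  have expM: "((\<lambda>s. \<mu> s * exp (M s)) has_integral exp (M t) - 1) {0..t}" if "t \<ge> 0" for t
  proof -
    have "((\<lambda>s. exp (M s)) has_vector_derivative \<mu> s * exp (M s)) (at s within {0..t})"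
      if "s \<in> {0..t}" for s
    proof -
      have "(M has_real_derivative \<mu> s) (at s within {0..t})"
        using M'[of s] that
        by (auto simp: has_real_derivative_iff_has_vector_derivative
            intro: has_vector_derivative_within_subset)
      then show ?thesis
        by (auto simp: has_real_derivative_iff_has_vector_derivative[symmetric]
            intro!: derivative_eq_intros)
    qed
    from fundamental_theorem_of_calculus[OF that this] show ?thesis by (simp add: M0)
  qed
  \<comment> \<open>An integrand dominated by the derivative of \<open>C * exp (M s)\<close> has an
    integral dominated by \<open>C * exp (M t)\<close>. Both the boundedness of the operator and its
    contraction follow from this estimate.\<close>
  have bound: "norm (integral {0..t} h) \<le> C * exp (M t)"
    if "t \<ge> 0" "C \<ge> 0" and h: "continuous_on {0..} h"
      and le: "\<And>s. s \<ge> 0 \<Longrightarrow> norm (h s) \<le> C * (\<mu> s * exp (M s))"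
    for h :: "real \<Rightarrow> 'a" and t C
  proof -
    have "norm (integral {0..t} h) \<le> integral {0..t} (\<lambda>s. C * (\<mu> s * exp (M s)))"
      using that by (intro integral_norm_bound_integral integrable_continuous_interval
          continuous_on_subset[OF h]) 
        (auto intro!: continuous_intros continuous_on_subset[OF contM] continuous_on_subset[OF contmu])
    also have "\<dots> = C * (exp (M t) - 1)"
      using expM[OF that(1)] by (simp add: integral_unique)
    also have "\<dots> \<le> C * exp (M t)" using that(2) by (simp add: algebra_simps)
    finally show ?thesis .
  qed
  \<comment> \<open>Solutions are sought in the form \<open>exp M \<cdot> \<psi>\<close> with \<open>\<psi>\<close> bounded: since \<open>M' \<ge> 2 \<bar>L\<bar>\<close>, the
    integral operator contracts the weighted supremum norm by \<open>1/2\<close> on the whole half-line.\<close>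
  define N where "N \<psi> s = F s (exp (M s) *\<^sub>R apply_bcontfun \<psi> s)" for \<psi> :: "real \<Rightarrow>\<^sub>C 'a" and s
  \<comment> \<open>Bounded continuous functions live on the whole line, so time is clipped at
    \<open>0\<close> and the image is constant for negative \<open>t\<close>.\<close>
  define T where "T \<psi> t = exp (- M (max 0 t)) *\<^sub>R (y0 + integral {0..max 0 t} (N \<psi>))"
    for \<psi> :: "real \<Rightarrow>\<^sub>C 'a" and t
  have contN: "continuous_on {0..} (N \<psi>)" for \<psi>
    unfolding N_def
    by (intro contF continuous_intros contM continuous_on_apply_bcontfun)
  have L_le: "L s \<le> 1/2 * \<mu> s" "L s \<le> \<mu> s" "norm (F s 0) \<le> \<mu> s" for s
    unfolding \<mu>_def using norm_ge_zero[of "F s 0"] abs_ge_self[of "L s"] abs_ge_zero[of "L s"]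
    by - argo+
  have \<mu>_pos: "\<mu> s > 0" for s by (simp add: \<mu>_def add_nonneg_pos)
  have T_bcontfun: "T \<psi> \<in> bcontfun" for \<psi>
  proof -
    have I: "continuous_on {0..} (\<lambda>t. integral {0..t} (N \<psi>))"
      using integral_has_vector_derivative_at_least[OF contN]
      by (auto simp: continuous_on_eq_continuous_within intro: has_vector_derivative_continuous)
    have "continuous_on UNIV (T \<psi>)"
      unfolding T_def
      by (intro continuous_intros continuous_on_compose2[OF contM] continuous_on_compose2[OF I]) auto
    moreover have "norm (T \<psi> t) \<le> norm y0 + (1 + norm \<psi>)" for t
    proof -
      define r where "r = max 0 t"
      have r: "r \<ge> 0" by (simp add: r_def)
      have "norm (integral {0..r} (N \<psi>)) \<le> (1 + norm \<psi>) * exp (M r)"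
      proof (rule bound[OF r _ contN])
        fix s :: real assume s: "s \<ge> 0"
        have "norm (N \<psi> s) \<le> norm (F s 0) + norm (N \<psi> s - F s 0)"
          by norm
        also have "norm (N \<psi> s - F s 0) \<le> L s * (exp (M s) * norm (apply_bcontfun \<psi> s))"
          using Lip[OF s, of _ 0] unfolding N_def by (metis abs_exp_cancel diff_zero norm_scaleR)
        also have "\<dots> \<le> \<mu> s * (exp (M s) * norm \<psi>)"
          using L_le[of s] \<mu>_pos[of s] norm_bounded[of \<psi> s]
          by (intro mult_mono) auto
        also have "norm (F s 0) \<le> \<mu> s * exp (M s)"
          using L_le(3)[of s] \<mu>_pos[of s] M_nonneg[OF s]
          by (smt (verit) mult_le_cancel_left1 one_le_exp_iff)
        finally show "norm (N \<psi> s) \<le> (1 + norm \<psi>) * (\<mu> s * exp (M s))"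
          by (simp add: algebra_simps)
      qed auto
      moreover have "norm y0 * 1 \<le> norm y0 * exp (M r)"
        using M_nonneg[OF r] by (intro mult_left_mono) auto
      ultimately have "norm (y0 + integral {0..r} (N \<psi>)) \<le> (norm y0 + (1 + norm \<psi>)) * exp (M r)"
        using norm_triangle_ineq[of y0 "integral {0..r} (N \<psi>)"] by (simp add: algebra_simps)
      then show ?thesis
        by (simp add: T_def r_def[symmetric] exp_minus divide_simps)
    qed
    ultimately show ?thesis by (rule bcontfun_normI)
  qed
  define S where "S \<psi> = Bcontfun (T \<psi>)" for \<psi>
  have S: "apply_bcontfun (S \<psi>) t = T \<psi> t" for \<psi> t
    by (simp add: S_def Bcontfun_inverse[OF T_bcontfun])
  have "dist (S \<psi>) (S \<xi>) \<le> 1/2 * dist \<psi> \<xi>" for \<psi> \<xi>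
  proof (rule dist_bound)
    fix t :: real
    define r where "r = max 0 t"
    have r: "r \<ge> 0" by (simp add: r_def)
    have "norm (integral {0..r} (\<lambda>s. N \<psi> s - N \<xi> s)) \<le> (1/2 * dist \<psi> \<xi>) * exp (M r)"
    proof (rule bound[OF r])
      fix s :: real assume s: "s \<ge> 0"
      have "norm (N \<psi> s - N \<xi> s)
          \<le> L s * (exp (M s) * dist (apply_bcontfun \<psi> s) (apply_bcontfun \<xi> s))"
        using Lip[OF s, of "exp (M s) *\<^sub>R apply_bcontfun \<psi> s" "exp (M s) *\<^sub>R apply_bcontfun \<xi> s"]
        unfolding N_def by (simp add: dist_norm scaleR_diff_right[symmetric])
      also have "\<dots> \<le> (1/2 * \<mu> s) * (exp (M s) * dist \<psi> \<xi>)"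
        using L_le(1)[of s] \<mu>_pos[of s] dist_bounded[of \<psi> s \<xi>]
        by (intro mult_mono) auto
      finally show "norm (N \<psi> s - N \<xi> s) \<le> 1/2 * dist \<psi> \<xi> * (\<mu> s * exp (M s))"
        by (simp add: algebra_simps)
    qed (auto intro!: continuous_intros contN)
    moreover have "integral {0..r} (\<lambda>s. N \<psi> s - N \<xi> s)
        = integral {0..r} (N \<psi>) - integral {0..r} (N \<xi>)"
      by (intro integral_diff integrable_continuous_interval continuous_on_subset[OF contN]) auto
    ultimately show "dist (apply_bcontfun (S \<psi>) t) (apply_bcontfun (S \<xi>) t) \<le> 1/2 * dist \<psi> \<xi>"
      by (simp add: S T_def r_def[symmetric] dist_norm scaleR_diff_right[symmetric] exp_minus divide_simps)
  qed
  then obtain \<psi> where fixpoint: "S \<psi> = \<psi>"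
    using banach_fix_type[of "1/2" S] by auto
  define y where "y t = y0 + integral {0..t} (N \<psi>)" for t
  have y_eq: "y t = exp (M t) *\<^sub>R apply_bcontfun \<psi> t" if "t \<ge> 0" for t
  proof -
    have "apply_bcontfun \<psi> t = exp (- M t) *\<^sub>R y t"
      using S[of \<psi> t] that by (simp add: fixpoint T_def y_def max_def)
    then show ?thesis by (simp add: exp_minus)
  qed
  show ?thesis
  proof
    show "y 0 = y0" by (simp add: y_def)
    fix t :: real assume t: "t \<ge> 0"
    have "N \<psi> t = F t (y t)" using y_eq[OF t] by (simp add: N_def)
    moreover have "(y has_vector_derivative N \<psi> t) (at t within {0..})"
      unfolding y_def
      using integral_has_vector_derivative_at_least[OF contN t]
      by (auto intro!: derivative_eq_intros)
    ultimately show "(y has_vector_derivative F t (y t)) (at t within {0..})" by simp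
  qed
qed

lemma nonneg_derivative_imp_le:
  fixes f :: "real \<Rightarrow> real"
  assumes "a \<le> b" "{a..b} \<subseteq> S"
    and f: "\<And>t. t \<in> {a..b} \<Longrightarrow> (f has_real_derivative f' t) (at t within S)"
    and nonneg: "\<And>t. t \<in> {a<..<b} \<Longrightarrow> f' t \<ge> 0"
  shows "f a \<le> f b"
proof (cases "a = b")
  case False
  have "\<exists>t\<in>{a<..<b}. f b - f a = f' t * (b - a)"
    using assms(1) False DERIV_subset[OF f assms(2)]
    by (intro mvt_simple) (auto dest: has_field_derivative_imp_has_derivative)
  then show ?thesis
    using assms(1) nonneg by (metis diff_ge_0_iff_ge mult_nonneg_nonneg)
qed simp

text \<open>After the last time at which \<open>f\<close> is at least \<open>m\<close>, the function
  lies below \<open>m\<close>, hence is nondecreasing there, and so cannot end below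
  \<open>m\<close>.\<close>

lemma barrier_from_below:
  fixes f :: "real \<Rightarrow> real"
  assumes "a \<le> b" "{a..b} \<subseteq> S" "m \<le> f a"
    and f: "\<And>t. t \<in> {a..b} \<Longrightarrow> (f has_real_derivative f' t) (at t within S)"
    and nonneg: "\<And>t. t \<in> {a..b} \<Longrightarrow> f t < m \<Longrightarrow> f' t \<ge> 0"
  shows "m \<le> f b"
proof (rule ccontr)
  assume "\<not> m \<le> f b"
  have cont: "continuous_on {a..b} f"
    by (rule DERIV_continuous_on[of _ _ f']) (rule DERIV_subset[OF f assms(2)])
  define Z where "Z = {a..b} \<inter> f -` {m..}"
  have "closed Z"
    unfolding Z_def by (intro continuous_closed_preimage cont) auto
  moreover have "bounded Z"
    by (rule bounded_subset[of "{a..b}"]) (auto simp: Z_def)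
  ultimately have "compact Z" by (simp add: compact_eq_bounded_closed)
  moreover have "Z \<noteq> {}" using assms(1,3) by (auto simp: Z_def)
  ultimately obtain s where s: "s \<in> Z" "\<And>t. t \<in> Z \<Longrightarrow> t \<le> s"
    using compact_attains_sup by metis
  have "f s \<le> f b"
  proof (rule nonneg_derivative_imp_le[where f = f and f' = f' and S = S])
    show "s \<le> b" "{s..b} \<subseteq> S" using s(1) assms(2) by (auto simp: Z_def)
    show "(f has_real_derivative f' t) (at t within S)" if "t \<in> {s..b}" for t
      using f that s(1) by (auto simp: Z_def)
    show "0 \<le> f' t" if "t \<in> {s<..<b}" for t
      using nonneg[of t] s(1) s(2)[of t] that by (cases "f t < m") (auto simp: Z_def)
  qed
  then show False using s(1) \<open>\<not> m \<le> f b\<close> by (simp add: Z_def)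
qed

text \<open>The factor is the exponential of the integral of \<open>r\<close>. Only its positivity
  is recorded: \<open>h\<close> keeps its sign, or stays zero, for all time.\<close>

lemma homogeneous_linear_ODE:
  fixes h r :: "real \<Rightarrow> real"
  assumes h: "\<And>t. t \<ge> 0 \<Longrightarrow> (h has_real_derivative r t * h t) (at t within {0..})"
    and r: "continuous_on {0..} r" and "t \<ge> 0"
  obtains k where "k > 0" "h t = k * h 0"
proof -
  define E where "E t = integral {0..t} r" for t
  have E: "(E has_real_derivative r s) (at s within {0..})" if "s \<ge> 0" for s
    unfolding E_def has_real_derivative_iff_has_vector_derivative
    using integral_has_vector_derivative_at_least[OF r that] .
  have "((\<lambda>s. h s * exp (- E s)) has_real_derivative 0) (at s within {0..})" if "s \<ge> 0" for s
    by (rule derivative_eq_intros h[OF that] E[OF that] refl)+ (simp add: algebra_simps)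
  then obtain C where C: "\<And>s. s \<ge> 0 \<Longrightarrow> h s * exp (- E s) = C"
    using has_field_derivative_zero_constant[of "{0..}" "\<lambda>s. h s * exp (- E s)"] by auto
  from C[of 0] have "C = h 0" by (simp add: E_def)
  with C[of t] \<open>t \<ge> 0\<close> have "h t = exp (E t) * h 0"
    by (simp add: exp_minus field_simps)
  then show ?thesis using that[of "exp (E t)"] by simp
qed

section \<open>The Abel equation\<close>

text \<open>With \<open>u = x0 / y0\<close> and \<open>v = 1 / y0\<close>, the two conditions on the
  initial data say that \<open>\<bar>u\<bar> \<le> \<delta>\<close> and
  \<open>v \<le> \<delta>\<close> for positive \<open>y0\<close>, that is, closeness to the origin
  of the chart.\<close>

lemma Abel_equation_global_solution:
  fixes q :: "real \<Rightarrow> real" and a \<gamma> C :: real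
  assumes q: "continuous_on UNIV q" and "\<gamma> > 0" "C \<ge> 0"
    and q_ge: "\<And>x. q x \<ge> \<gamma> * x\<^sup>2 - C"
  obtains \<delta> where "\<delta> > 0"
    and "\<And>x0 y0. \<bar>x0\<bar> \<le> \<delta> * y0 \<Longrightarrow> 1 \<le> \<delta> * y0 \<Longrightarrow>
      \<exists>y. y 0 = y0 \<and> (\<forall>t\<ge>0. y t > 0 \<and>
        (y has_real_derivative a + q (x0 + t) / y t) (at t within {0..}))"
proof -
  \<comment> \<open>While the denominator is at least \<open>m > C\<close>, the slope of
    \<open>y\<close> is at least \<open>- A\<close>. For \<open>x \<ge> K\<close> one has
    \<open>q x \<ge> m * A\<close>, which makes the slope nonnegative at height \<open>m\<close>.
    The choice of \<open>\<delta>\<close> forces \<open>y0\<close> to exceed by at least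
    \<open>m\<close> the loss \<open>A * (K + \<bar>x0\<bar>)\<close> that can occur before
    \<open>x\<close> reaches \<open>K\<close>.\<close>
  define A where "A = \<bar>a\<bar> + 1"
  define m where "m = C + 1"
  define K where "K = 1 + (m * A + C) / \<gamma>"
  define \<delta> where "\<delta> = 1 / (2 * A + 2 * (m + A * K))"
  have pos: "A \<ge> 1" "m \<ge> 1" "K \<ge> 1"
    using assms by (simp_all add: A_def m_def K_def)
  have q_ge': "q x \<ge> - C" for x
  proof -
    have "0 \<le> \<gamma> * x\<^sup>2" using \<open>\<gamma> > 0\<close> by simp
    then show ?thesis using q_ge[of x] by linarith
  qed
  have q_ge_K: "q x \<ge> m * A" if "x \<ge> K" for x
  proof -
    have "x * 1 \<le> x * x" using that pos by (intro mult_left_mono) auto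
    then have "K \<le> x\<^sup>2" using that by (simp add: power2_eq_square)
    then have "\<gamma> * K \<le> \<gamma> * x\<^sup>2" using \<open>\<gamma> > 0\<close> by simp
    moreover have "\<gamma> * K = \<gamma> + m * A + C" using \<open>\<gamma> > 0\<close> by (simp add: K_def field_simps)
    ultimately show ?thesis using q_ge[of x] \<open>\<gamma> > 0\<close> by linarith
  qed
  have "A * K > 0" using pos by simp
  have den: "2 * A + 2 * (m + A * K) > 0" using pos \<open>A * K > 0\<close> by (auto intro!: add_pos_pos)
  show ?thesis
  proof
    show "\<delta> > 0" using den by (simp add: \<delta>_def)
    fix x0 y0 :: real
    assume x0: "\<bar>x0\<bar> \<le> \<delta> * y0" and y0: "1 \<le> \<delta> * y0"
    have y0_ge: "2 * A + 2 * (m + A * K) \<le> y0"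
      using y0 den by (simp add: \<delta>_def field_simps)
    have "A * \<bar>x0\<bar> \<le> y0 / 2"
    proof -
      have "2 * A * \<bar>x0\<bar> \<le> (2 * A + 2 * (m + A * K)) * \<bar>x0\<bar>"
        using pos \<open>A * K > 0\<close> by (intro mult_right_mono) auto
      also have "\<dots> \<le> y0" using x0 den by (simp add: \<delta>_def field_simps)
      finally show ?thesis by simp
    qed
    with y0_ge have y0_ge': "y0 - A * (K + \<bar>x0\<bar>) \<ge> m"
      using pos by (simp add: algebra_simps)
    \<comment> \<open>Truncating the denominator makes the equation globally Lipschitz in \<open>y\<close>; the solution turns
      out to stay above \<open>m\<close>, where the truncation has no effect.\<close>
    define F where "F t y = a + q (x0 + t) / max y m" for t y
    obtain y where "y 0 = y0"
      and y: "\<And>t. t \<ge> 0 \<Longrightarrow> (y has_vector_derivative F t (y t)) (at t within {0..})"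
    proof (rule global_Lipschitz_ODE_solution[of F "\<lambda>t. \<bar>q (x0 + t)\<bar>" y0])
      show "continuous_on ({0..} \<times> UNIV) (\<lambda>(t, y). F t y)"
        unfolding F_def case_prod_beta using pos
        by (intro continuous_intros continuous_on_compose2[OF q]) (auto simp: max_def)
      show "continuous_on {0..} (\<lambda>t. \<bar>q (x0 + t)\<bar>)"
        by (intro continuous_intros continuous_on_compose2[OF q]) auto
      fix t y z :: real
      \<comment> \<open>Both truncated values are at least \<open>1\<close>, and there the
        reciprocal has Lipschitz constant \<open>1\<close>.\<close>
      have "\<bar>1 / max y m - 1 / max z m\<bar> \<le> \<bar>y - z\<bar>"
      proof -
        have "1 * 1 \<le> max y m * max z m" using pos by (intro mult_mono) auto
        moreover have "\<bar>max z m - max y m\<bar> \<le> \<bar>y - z\<bar> * 1"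
          by (auto simp: max_def abs_if)
        moreover from calculation have "\<bar>y - z\<bar> * 1 \<le> \<bar>y - z\<bar> * (max y m * max z m)"
          by (intro mult_left_mono) auto
        ultimately have "\<bar>max z m - max y m\<bar> \<le> \<bar>y - z\<bar> * (max y m * max z m)"
          by linarith
        moreover have "max y m > 0" "max z m > 0" using pos by auto
        moreover from this have "1 / max y m - 1 / max z m = (max z m - max y m) / (max y m * max z m)"
          by (simp add: field_simps)
        ultimately show ?thesis by (simp add: abs_mult divide_le_eq)
      qed
      then have "\<bar>q (x0 + t)\<bar> * \<bar>1 / max y m - 1 / max z m\<bar> \<le> \<bar>q (x0 + t)\<bar> * \<bar>y - z\<bar>"
        by (rule mult_left_mono) simp
      then show "norm (F t y - F t z) \<le> \<bar>q (x0 + t)\<bar> * norm (y - z)"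
        by (simp add: F_def abs_mult[symmetric] right_diff_distrib)
    qed auto
    then have y': "(y has_real_derivative F t (y t)) (at t within {0..})" if "t \<ge> 0" for t
      using that by (simp add: has_real_derivative_iff_has_vector_derivative)
    have F_ge: "F t z \<ge> - A" for t z
    proof -
      have "max z m > 0" "C \<le> max z m" using pos by (auto simp: m_def)
      then have "- 1 \<le> - C / max z m" by (simp add: field_simps)
      also have "\<dots> \<le> q (x0 + t) / max z m"
        using q_ge'[of "x0 + t"] pos by (intro divide_right_mono) auto
      finally show ?thesis unfolding F_def A_def by linarith
    qed
    \<comment> \<open>From \<open>t1\<close> on, \<open>x0 + t\<close> is at least \<open>K\<close>.
      Before \<open>t1\<close> the size of \<open>y0\<close> pays for a loss at rate at most
      \<open>A\<close>; afterwards \<open>m\<close> is a barrier.\<close>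
    define t1 where "t1 = max 0 (K - x0)"
    have y_init: "y t \<ge> m" if "0 \<le> t" "t \<le> t1" for t
    proof -
      have "y 0 + A * 0 \<le> y t + A * t"
      proof (rule nonneg_derivative_imp_le[where f = "\<lambda>t. y t + A * t" and S = "{0..}"])
        show "((\<lambda>t. y t + A * t) has_real_derivative F s (y s) + A) (at s within {0..})"
          if "s \<in> {0..t}" for s
          using that by (auto intro!: derivative_eq_intros y')
        show "0 \<le> F s (y s) + A" for s using F_ge[of s "y s"] by simp
      qed (use that in auto)
      moreover have "A * t \<le> A * (K + \<bar>x0\<bar>)"
        using that pos by (intro mult_left_mono) (auto simp: t1_def)
      ultimately show ?thesis using y0_ge' \<open>y 0 = y0\<close> by simp
    qed
    have y_ge: "y t \<ge> m" if "t \<ge> 0" for t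
    proof (cases "t \<le> t1")
      case False
      show ?thesis
      proof (rule barrier_from_below[where f = y and S = "{0..}" and a = t1])
        show "m \<le> y t1" by (rule y_init) (auto simp: t1_def)
        show "(y has_real_derivative F s (y s)) (at s within {0..})" if "s \<in> {t1..t}" for s
          using y' that by (auto simp: t1_def)
        show "0 \<le> F s (y s)" if "s \<in> {t1..t}" "y s < m" for s
        proof -
          have "m * A \<le> q (x0 + s)" using that by (intro q_ge_K) (auto simp: t1_def)
          then have "A \<le> q (x0 + s) / m" using pos by (simp add: field_simps)
          then show ?thesis using that by (simp add: F_def A_def max_def)
        qed
      qed (use False in \<open>auto simp: t1_def\<close>)
    qed (use that y_init in auto)
    have "y t > 0 \<and> (y has_real_derivative a + q (x0 + t) / y t) (at t within {0..})"
      if "t \<ge> 0" for t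
      using y'[OF that] y_ge[OF that] pos by (simp add: F_def max_def)
    then show "\<exists>y. y 0 = y0 \<and> (\<forall>t\<ge>0. y t > 0 \<and>
        (y has_real_derivative a + q (x0 + t) / y t) (at t within {0..}))"
      using \<open>y 0 = y0\<close> by blast
  qed
qed

text \<open>The balance of \<open>y * y'\<close> against \<open>\<gamma> * X\<^sup>2\<close>, for
  \<open>X = x0 + t\<close>, suggests that \<open>y\<^sup>2\<close> grows at least like
  \<open>X\<^sup>3\<close>; the term with \<open>a\<close> is of lower order. Since
  \<open>y = 1 / v\<close>, the quotient in the conclusion is the coordinate
  \<open>u\<close>.\<close>

lemma Abel_equation_superlinear_growth:
  fixes q y :: "real \<Rightarrow> real" and a \<gamma> C x0 :: real
  assumes "\<gamma> > 0" "C \<ge> 0" and q_ge: "\<And>x. q x \<ge> \<gamma> * x\<^sup>2 - C"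
    and y_pos: "\<And>t. t \<ge> 0 \<Longrightarrow> y t > 0"
    and y': "\<And>t. t \<ge> 0 \<Longrightarrow> (y has_real_derivative a + q (x0 + t) / y t) (at t within {0..})"
  shows "((\<lambda>t. (x0 + t) / y t) \<longlongrightarrow> 0) at_top"
proof -
  \<comment> \<open>A natural exponent \<open>n \<ge> \<bar>a\<bar>\<close> avoids real powers, and
    its form \<open>Suc k\<close> lets the derivative of \<open>X ^ n\<close> be written with
    \<open>X ^ k\<close>.\<close>
  define k where "k = nat \<lceil>\<bar>a\<bar>\<rceil>"
  define n where "n = Suc k"
  have n: "\<bar>a\<bar> \<le> real n" unfolding n_def k_def by linarith
  \<comment> \<open>For \<open>X \<ge> K\<close> the term \<open>\<gamma> * X\<^sup>2\<close> is at
    least \<open>real n * X + 2 * C\<close>. Thus one half of the growth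
    \<open>2 * \<gamma> * X\<^sup>2\<close> contained in \<open>2 * q X\<close> absorbs the errors
    and the other half remains.\<close>
  define K where "K = 1 + (real n + 2 * C) / \<gamma>"
  have "K \<ge> 1" using assms(1,2) by (simp add: K_def)
  define t1 where "t1 = max 0 (K - x0)"
  have t1: "t \<ge> 0" "x0 + t \<ge> K" if "t \<ge> t1" for t using that by (auto simp: t1_def)
  \<comment> \<open>Chosen so that \<open>\<kappa> * X ^ (n + 3)\<close> has derivative
    \<open>\<gamma> * X ^ (n + 2)\<close>.\<close>
  define \<kappa> where "\<kappa> = \<gamma> / (real n + 3)"
  have \<kappa>: "\<kappa> > 0" "\<kappa> * (real n + 3) = \<gamma>" using assms(1) by (auto simp: \<kappa>_def add_nonneg_pos)
  \<comment> \<open>For \<open>X = x0 + t\<close> and \<open>z = y\<^sup>2\<close> one has \<open>z' = 2 a y + 2 q(X) \<ge> - n z / X + \<gamma> X\<^sup>2\<close> for large \<open>X\<close>,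
    because \<open>2 y \<le> z / X + X\<close>; the integrating factor is \<open>X ^ n\<close>.\<close>
  define h where "h t = (x0 + t) ^ n * (y t)\<^sup>2 - \<kappa> * (x0 + t) ^ (n + 3)" for t
  define h' where "h' t = real n * (x0 + t) ^ k * (y t)\<^sup>2
      + (x0 + t) ^ n * (2 * a * y t + 2 * q (x0 + t)) - \<gamma> * (x0 + t) ^ (n + 2)" for t
  have h: "(h has_real_derivative h' t) (at t within {0..})" if "t \<ge> 0" for t
    unfolding h_def
    by (rule derivative_eq_intros y'[OF that] refl)+
      (use y_pos[OF that] in \<open>simp add: h'_def n_def \<kappa>(2)[symmetric] field_simps power2_eq_square eval_nat_numeral\<close>)
  have h'_nonneg: "h' t \<ge> 0" if "t \<ge> t1" for t
  proof -
    define X where "X = x0 + t"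
    have X: "X \<ge> K" "X \<ge> 1" using t1[OF that] \<open>K \<ge> 1\<close> by (auto simp: X_def)
    have y: "y t > 0" using y_pos t1(1)[OF that] .
    have "2 * \<bar>a\<bar> * y t \<le> real n * ((y t)\<^sup>2 / X + X)"
    proof -
      have "0 \<le> (y t - X)\<^sup>2" by simp
      then have "2 * y t * X \<le> (y t)\<^sup>2 + X * X" by (simp add: power2_eq_square algebra_simps)
      then have "2 * y t \<le> (y t)\<^sup>2 / X + X" using X by (simp add: field_simps)
      then have "\<bar>a\<bar> * (2 * y t) \<le> real n * ((y t)\<^sup>2 / X + X)"
        using n y by (intro mult_mono) auto
      then show ?thesis by (simp add: mult.assoc mult.left_commute)
    qed
    moreover have "- (2 * \<bar>a\<bar> * y t) \<le> 2 * a * y t"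
    proof -
      have "- \<bar>a\<bar> * (2 * y t) \<le> a * (2 * y t)" using y by (intro mult_right_mono) auto
      then show ?thesis by (simp add: algebra_simps)
    qed
    moreover have "real n * X + 2 * C \<le> \<gamma> * X\<^sup>2"
    proof -
      have "real n * X + 2 * C * 1 \<le> real n * X + 2 * C * X"
        using X assms(2) by (intro add_left_mono mult_left_mono) auto
      also have "\<dots> \<le> \<gamma> * K * X"
        using assms(1) X by (simp add: K_def field_simps)
      also have "\<dots> \<le> \<gamma> * X * X" using X assms(1) \<open>K \<ge> 1\<close> by (intro mult_mono) auto
      finally show ?thesis by (simp add: power2_eq_square)
    qed
    moreover have "real n * ((y t)\<^sup>2 / X + X) = real n * (y t)\<^sup>2 / X + real n * X"
      by (simp add: algebra_simps)
    ultimately have "\<gamma> * X\<^sup>2 - real n * (y t)\<^sup>2 / X \<le> 2 * a * y t + 2 * q X"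
      using q_ge[of X] by linarith
    then have "X ^ n * (\<gamma> * X\<^sup>2 - real n * (y t)\<^sup>2 / X) \<le> X ^ n * (2 * a * y t + 2 * q X)"
      using X by (intro mult_left_mono) auto
    also have "X ^ n * (\<gamma> * X\<^sup>2 - real n * (y t)\<^sup>2 / X) = \<gamma> * X ^ (n + 2) - real n * X ^ k * (y t)\<^sup>2"
      using X by (simp add: n_def field_simps power_add power2_eq_square)
    finally show ?thesis by (simp add: h'_def X_def)
  qed
  \<comment> \<open>Monotonicity gives \<open>h t \<ge> - H\<close>. As \<open>X \<ge> 1\<close>,
    the constant may be enlarged to \<open>X ^ (n + 2) * H\<close>; cancelling \<open>X ^ n\<close>
    then leaves \<open>y\<^sup>2 \<ge> X\<^sup>2 * (\<kappa> * X - H)\<close>.\<close>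
  define H where "H = \<bar>h t1\<bar>"
  have bound: "((x0 + t) / y t)\<^sup>2 \<le> 1 / (\<kappa> * (x0 + t) - H)"
    if "t \<ge> t1" "\<kappa> * (x0 + t) - H > 0" for t
  proof -
    define X where "X = x0 + t"
    have X: "X \<ge> 1" using t1[OF that(1)] \<open>K \<ge> 1\<close> by (auto simp: X_def)
    have "h t1 \<le> h t"
    proof (rule nonneg_derivative_imp_le[where f = h and f' = h' and S = "{0..}"])
      show "(h has_real_derivative h' s) (at s within {0..})" if "s \<in> {t1..t}" for s
        using h t1(1) that by auto
    qed (use that t1(1)[of t1] h'_nonneg in auto)
    moreover have "1 * H \<le> X ^ (n + 2) * H"
      using X by (intro mult_right_mono one_le_power) (auto simp: H_def)
    moreover have "- H \<le> h t1" by (simp add: H_def)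
    moreover have "h t = X ^ n * (y t)\<^sup>2 - \<kappa> * X ^ (n + 3)"
      by (simp add: h_def X_def)
    moreover have "X ^ n * (X\<^sup>2 * (\<kappa> * X - H)) = \<kappa> * X ^ (n + 3) - X ^ (n + 2) * H"
      by (simp add: algebra_simps power_add power2_eq_square power3_eq_cube)
    ultimately have "X ^ n * (X\<^sup>2 * (\<kappa> * X - H)) \<le> X ^ n * (y t)\<^sup>2"
      by linarith
    then have "X\<^sup>2 * (\<kappa> * X - H) \<le> (y t)\<^sup>2"
      using X by (simp add: mult_le_cancel_left_pos)
    then show ?thesis
      using that(2) y_pos[OF t1(1)[OF that(1)]]
      by (simp add: X_def power_divide divide_le_eq le_divide_eq field_simps)
  qed
  have top: "filterlim (\<lambda>t. \<kappa> * (x0 + t) - H) at_top at_top"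
    unfolding filterlim_at_top
  proof
    fix Z
    show "\<forall>\<^sub>F t in at_top. Z \<le> \<kappa> * (x0 + t) - H"
      using eventually_ge_at_top[of "(Z + H) / \<kappa> - x0"]
      by eventually_elim (use \<kappa> in \<open>simp add: field_simps\<close>)
  qed
  have ev: "\<forall>\<^sub>F t in at_top. ((x0 + t) / y t)\<^sup>2 \<le> 1 / (\<kappa> * (x0 + t) - H)"
    using eventually_ge_at_top[of t1] filterlim_at_top_dense[THEN iffD1, OF top, rule_format, of 0]
    by eventually_elim (rule bound)
  have "((\<lambda>t. 1 / (\<kappa> * (x0 + t) - H)) \<longlongrightarrow> 0) at_top"
    by (rule tendsto_divide_0[OF tendsto_const filterlim_at_top_imp_at_infinity[OF top]])
  then have "((\<lambda>t. ((x0 + t) / y t)\<^sup>2) \<longlongrightarrow> 0) at_top"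
    by (rule tendsto_sandwich[OF _ ev tendsto_const, rotated]) auto
  from tendsto_real_sqrt[OF this] show ?thesis
    by (simp add: tendsto_rabs_zero_iff del: abs_divide)
qed

section \<open>Orbits of the chart field\<close>

text \<open>This is the logarithmic derivative of \<open>v\<close> along orbits off the axis
  \<open>v = 0\<close>, and that of \<open>u\<close> along nonzero orbits on it.\<close>

definition chart_rate :: "real \<Rightarrow> real \<Rightarrow> real \<Rightarrow> real \<Rightarrow> real \<Rightarrow> real" where
  "chart_rate b c d u v = - (d * v / 2) + 3 / 2 * b * u * v + c * u\<^sup>2"

definition chart_field :: "real \<Rightarrow> real \<Rightarrow> real \<Rightarrow> real \<times> real \<Rightarrow> real \<times> real" where
  "chart_field b c d =
     (\<lambda>(u, v). (v + u * chart_rate b c d u v, v * chart_rate b c d u v))"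

lemma solves_chart_field_iff:
  "solves_ode_on (chart_field b c d) T x \<longleftrightarrow>
    (\<forall>t\<in>T. ((\<lambda>t. fst (x t)) has_real_derivative
        snd (x t) + fst (x t) * chart_rate b c d (fst (x t)) (snd (x t))) (at t within T) \<and>
      ((\<lambda>t. snd (x t)) has_real_derivative
        snd (x t) * chart_rate b c d (fst (x t)) (snd (x t))) (at t within T))"
proof -
  have "(x has_vector_derivative (p, q)) (at t within T) \<longleftrightarrow>
      ((\<lambda>t. fst (x t)) has_vector_derivative p) (at t within T) \<and>
      ((\<lambda>t. snd (x t)) has_vector_derivative q) (at t within T)" for p q t
    using bounded_linear.has_vector_derivative[OF bounded_linear_fst, of x "(p, q)" "at t within T"]
      bounded_linear.has_vector_derivative[OF bounded_linear_snd, of x "(p, q)" "at t within T"]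
      has_vector_derivative_Pair[of "\<lambda>t. fst (x t)" p t T "\<lambda>t. snd (x t)" q]
    by (simp only: prod.collapse fst_conv snd_conv) blast
  then show ?thesis
    by (simp add: solves_ode_on_def chart_field_def case_prod_beta
        has_real_derivative_iff_has_vector_derivative)
qed

lemma continuous_on_chart_rate:
  assumes "solves_ode_on (chart_field b c d) T x"
  shows "continuous_on T (\<lambda>t. chart_rate b c d (fst (x t)) (snd (x t)))"
proof -
  have "continuous_on T x"
    using assms
    by (auto simp: solves_ode_on_def continuous_on_eq_continuous_within
        intro: has_vector_derivative_continuous)
  then show ?thesis
    unfolding chart_rate_def by (auto intro!: continuous_intros)
qed

text \<open>Normalising removes the positive factor \<open>u t\<close>, so the direction is that of
  \<open>(1, r t)\<close>, which tends to \<open>(1, 0)\<close>.\<close>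

lemma tends_with_tangent_of_slope:
  assumes x: "\<forall>\<^sub>F t in L. x t = (u t, u t * r t) \<and> u t > 0"
    and u: "(u \<longlongrightarrow> 0) L" and r: "(r \<longlongrightarrow> 0) L"
  shows "tends_with_tangent x (0, 0) L"
proof -
  have "((\<lambda>t. (u t, u t * r t)) \<longlongrightarrow> (0, 0 * 0)) L"
    by (intro tendsto_intros u r)
  moreover have "\<forall>\<^sub>F t in L. (u t, u t * r t) = x t"
    using x by eventually_elim simp
  ultimately have lim: "(x \<longlongrightarrow> (0, 0)) L"
    by (auto dest: Lim_transform_eventually)
  have "((\<lambda>t. sgn (1 :: real, r t)) \<longlongrightarrow> sgn (1, 0)) L"
    by (intro tendsto_intros r) (simp add: zero_prod_def)
  moreover have "\<forall>\<^sub>F t in L. sgn (1, r t) = sgn (x t - (0, 0))"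
    using x
  proof eventually_elim
    case (elim t)
    then have "x t - (0, 0) = u t *\<^sub>R (1, r t)" by simp
    then show ?case using elim by (simp only: sgn_scaleR) simp
  qed
  ultimately have "((\<lambda>t. sgn (x t - (0, 0))) \<longlongrightarrow> sgn (1, 0)) L"
    by (rule Lim_transform_eventually)
  moreover have "norm (sgn (1 :: real, 0 :: real)) = 1"
    by (simp add: norm_sgn zero_prod_def)
  ultimately show ?thesis
    using lim unfolding tends_with_tangent_def by blast
qed

text \<open>Completing the square: half of the quadratic term absorbs the linear one. This supplies
  the constants \<open>\<gamma>\<close> and \<open>C\<close> for the Abel equation.\<close>

lemma quadratic_minus_linear_ge:
  fixes b c x :: real
  assumes "c < 0"
  shows "- c * x\<^sup>2 - 3 / 2 * b * x \<ge> (- c / 2) * x\<^sup>2 - 9 * b\<^sup>2 / (8 * - c)"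
proof -
  have "0 \<le> (- c * x - 3 / 2 * b)\<^sup>2 / (2 * - c)"
    using assms by (intro divide_nonneg_pos) auto
  also have "\<dots> = (- c / 2) * x\<^sup>2 - 3 / 2 * b * x + 9 * b\<^sup>2 / (8 * - c)"
    using assms by (simp add: field_simps power2_eq_square)
  finally show ?thesis by (simp add: algebra_simps)
qed

text \<open>The change to \<open>x = u / v\<close>, \<open>y = 1 / v\<close> is applied to an
  arbitrary solution on the half-line, because the definition of a node quantifies over all of
  them.\<close>

lemma chart_field_tends_upper:
  assumes "c < 0" and x: "solves_ode_on (chart_field b c d) {0..} x" and "snd (x 0) > 0"
  shows "tends_with_tangent x (0, 0) at_top"
proof -
  define u v where "u t = fst (x t)" and "v t = snd (x t)" for t
  define R where "R t = chart_rate b c d (u t) (v t)" for t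
  have u': "(u has_real_derivative v t + u t * R t) (at t within {0..})"
    and v': "(v has_real_derivative v t * R t) (at t within {0..})" if "t \<ge> 0" for t
    using x that by (auto simp: solves_chart_field_iff u_def[abs_def] v_def[abs_def] R_def)
  have v_pos: "v t > 0" if t: "t \<ge> 0" for t
  proof -
    obtain k where "k > 0" "v t = k * v 0"
    proof (rule homogeneous_linear_ODE[of v R t])
      show "(v has_real_derivative R s * v s) (at s within {0..})" if "s \<ge> 0" for s
        using v'[OF that] by (simp add: mult.commute)
      show "continuous_on {0..} R"
        using continuous_on_chart_rate[OF x] by (simp add: R_def u_def v_def)
    qed (use t in auto)
    then show ?thesis using assms(3) by (simp add: v_def)
  qed
  define x0 where "x0 = u 0 / v 0"
  have u_eq: "u t = (x0 + t) * v t" if "t \<ge> 0" for t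
  proof -
    \<comment> \<open>In the derivative of \<open>u / v\<close> the two terms with \<open>R\<close>
      cancel and \<open>v / v = 1\<close> is left.\<close>
    have "((\<lambda>s. - s + u s / v s) has_real_derivative 0) (at s within {0..})" if "s \<ge> 0" for s
      by (rule derivative_eq_intros u'[OF that] v'[OF that] refl)+
        (use v_pos[OF that] in \<open>simp_all add: field_simps\<close>)
    then obtain C where C: "\<And>s. s \<ge> 0 \<Longrightarrow> - s + u s / v s = C"
      using has_field_derivative_zero_constant[of "{0..}" "\<lambda>s. - s + u s / v s"] by auto
    have "u t / v t = x0 + t"
      using C[of 0] C[OF that] by (simp add: x0_def)
    then show ?thesis using v_pos[OF that] by (simp add: field_simps)
  qed
  define q where "q z = - c * z\<^sup>2 - 3 / 2 * b * z" for z
  have "((\<lambda>t. (x0 + t) / (1 / v t)) \<longlongrightarrow> 0) at_top"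
  proof (rule Abel_equation_superlinear_growth[where q = q and a = "d / 2"])
    show "- c / 2 > 0" "9 * b\<^sup>2 / (8 * - c) \<ge> 0"
      using \<open>c < 0\<close> by (auto simp: divide_le_0_iff)
    show "(- c / 2) * z\<^sup>2 - 9 * b\<^sup>2 / (8 * - c) \<le> q z" for z
      unfolding q_def by (rule quadratic_minus_linear_ge[OF \<open>c < 0\<close>])
    show "1 / v t > 0" if "t \<ge> 0" for t using v_pos[OF that] by simp
    show "((\<lambda>t. 1 / v t) has_real_derivative d / 2 + q (x0 + t) / (1 / v t)) (at t within {0..})"
      if "t \<ge> 0" for t
      by (rule derivative_eq_intros v'[OF that] refl)+
        (use v_pos[OF that] in \<open>simp_all add: R_def chart_rate_def u_eq[OF that] q_def field_simps power2_eq_square\<close>)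
  qed
  then have lim: "((\<lambda>t. (x0 + t) * v t) \<longlongrightarrow> 0) at_top" by simp
  show ?thesis
  proof (rule tends_with_tangent_of_slope)
    show "((\<lambda>t. (x0 + t) * v t) \<longlongrightarrow> 0) at_top" by fact
    \<comment> \<open>The coordinate \<open>u\<close> may start negative; it is positive once
      \<open>t\<close> exceeds \<open>- x0\<close>.\<close>
    show "\<forall>\<^sub>F t in at_top. x t = ((x0 + t) * v t, (x0 + t) * v t * (1 / (x0 + t))) \<and> (x0 + t) * v t > 0"
      using eventually_ge_at_top[of 0] eventually_gt_at_top[of "- x0"]
    proof eventually_elim
      case (elim t)
      then have "x0 + t > 0" by simp
      then show ?case
        using u_eq[OF elim(1)] v_pos[OF elim(1)] by (auto simp: prod_eq_iff u_def v_def)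
    qed
    have "filterlim (\<lambda>t. x0 + t) at_top at_top"
      by (rule filterlim_tendsto_add_at_top[OF tendsto_const filterlim_ident])
    then show "((\<lambda>t. 1 / (x0 + t)) \<longlongrightarrow> 0) at_top"
      by (intro tendsto_divide_0[OF tendsto_const] filterlim_at_top_imp_at_infinity)
  qed
qed

text \<open>Existence runs the change of variables backwards: a global positive solution
  \<open>y\<close> of the Abel equation gives the orbit with \<open>u = (x0 + t) / y\<close> and
  \<open>v = 1 / y\<close>.\<close>

lemma chart_field_solution_upper:
  assumes "c < 0"
  obtains \<delta> where "\<delta> > 0"
    and "\<And>u v. \<bar>u\<bar> \<le> \<delta> \<Longrightarrow> 0 < v \<Longrightarrow> v \<le> \<delta> \<Longrightarrow>
      \<exists>x. solves_ode_on (chart_field b c d) {0..} x \<and> x 0 = (u, v)"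
proof -
  define q where "q z = - c * z\<^sup>2 - 3 / 2 * b * z" for z
  have "continuous_on UNIV q" unfolding q_def by (intro continuous_intros)
  moreover have "- c / 2 > 0" "9 * b\<^sup>2 / (8 * - c) \<ge> 0"
    using \<open>c < 0\<close> by (auto simp: divide_le_0_iff)
  moreover have "(- c / 2) * z\<^sup>2 - 9 * b\<^sup>2 / (8 * - c) \<le> q z" for z
    unfolding q_def by (rule quadratic_minus_linear_ge[OF \<open>c < 0\<close>])
  ultimately obtain \<delta> where "\<delta> > 0"
    and sol: "\<And>x0 y0. \<bar>x0\<bar> \<le> \<delta> * y0 \<Longrightarrow> 1 \<le> \<delta> * y0 \<Longrightarrow>
      \<exists>y. y 0 = y0 \<and> (\<forall>t\<ge>0. y t > 0 \<and>
        (y has_real_derivative d / 2 + q (x0 + t) / y t) (at t within {0..}))"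
    by (rule Abel_equation_global_solution[where a = "d / 2"]) blast
  show ?thesis
  proof
    fix u v :: real
    assume u: "\<bar>u\<bar> \<le> \<delta>" and v: "0 < v" "v \<le> \<delta>"
    define x0 where "x0 = u / v"
    have "\<bar>x0\<bar> \<le> \<delta> * (1 / v)" "1 \<le> \<delta> * (1 / v)"
      using u v by (simp_all add: x0_def abs_divide divide_right_mono)
    from sol[OF this] obtain y where "y 0 = 1 / v" and y_pos: "\<And>t. t \<ge> 0 \<Longrightarrow> y t > 0"
      and y': "\<And>t. t \<ge> 0 \<Longrightarrow>
        (y has_real_derivative d / 2 + q (x0 + t) / y t) (at t within {0..})"
      by blast
    have "solves_ode_on (chart_field b c d) {0..} (\<lambda>t. ((x0 + t) / y t, 1 / y t))"
      unfolding solves_chart_field_iff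
    proof (intro ballI conjI, simp_all only: fst_conv snd_conv)
      fix t :: real assume "t \<in> {0..}"
      then have t: "t \<ge> 0" by simp
      define D where "D = d / 2 + q (x0 + t) / y t"
      have D: "(y has_real_derivative D) (at t within {0..})"
        using y'[OF t] by (simp add: D_def)
      have rate: "chart_rate b c d ((x0 + t) / y t) (1 / y t) = - D / y t"
        using y_pos[OF t]
        by (simp add: D_def chart_rate_def q_def field_simps power2_eq_square)
      have inv: "((\<lambda>t. 1 / y t) has_real_derivative 1 / y t * (- D / y t)) (at t within {0..})"
        by (rule derivative_eq_intros D refl)+ (use y_pos[OF t] in simp_all)
      then show "((\<lambda>t. 1 / y t) has_real_derivative
          1 / y t * chart_rate b c d ((x0 + t) / y t) (1 / y t)) (at t within {0..})"
        by (simp only: rate)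
      have "((\<lambda>t. (x0 + t) * (1 / y t)) has_real_derivative
          (0 + 1) * (1 / y t) + (1 / y t * (- D / y t)) * (x0 + t)) (at t within {0..})"
        by (intro DERIV_mult DERIV_add DERIV_const DERIV_ident inv)
      then show "((\<lambda>t. (x0 + t) / y t) has_real_derivative
          1 / y t + (x0 + t) / y t * chart_rate b c d ((x0 + t) / y t) (1 / y t)) (at t within {0..})"
        unfolding rate by (simp add: mult.commute)
    qed
    moreover have "((x0 + 0) / y 0, 1 / y 0) = (u, v)"
      using v \<open>y 0 = 1 / v\<close> by (simp add: x0_def)
    ultimately show "\<exists>x. solves_ode_on (chart_field b c d) {0..} x \<and> x 0 = (u, v)"
      by blast
  qed fact
qed

text \<open>The axis is invariant, and on it \<open>u' = c * u ^ 3\<close>. Hence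
  \<open>1 / u\<^sup>2\<close> grows linearly with slope \<open>- 2 * c\<close>, while
  \<open>u\<close> keeps its sign, so the direction is constant along the orbit.\<close>

lemma chart_field_tends_axis:
  assumes "c < 0" and x: "solves_ode_on (chart_field b c d) {0..} x"
    and "snd (x 0) = 0" "fst (x 0) \<noteq> 0"
  shows "tends_with_tangent x (0, 0) at_top"
proof -
  define u v where "u t = fst (x t)" and "v t = snd (x t)" for t
  define R where "R t = chart_rate b c d (u t) (v t)" for t
  have contR: "continuous_on {0..} R"
    using continuous_on_chart_rate[OF x] by (simp add: R_def u_def v_def)
  have u': "(u has_real_derivative v t + u t * R t) (at t within {0..})"
    and v': "(v has_real_derivative v t * R t) (at t within {0..})" if "t \<ge> 0" for t
    using x that by (auto simp: solves_chart_field_iff u_def[abs_def] v_def[abs_def] R_def)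
  have v_0: "v t = 0" if t: "t \<ge> 0" for t
  proof -
    obtain k where "v t = k * v 0"
      using homogeneous_linear_ODE[of v R t] v' contR t by (auto simp: mult.commute)
    then show ?thesis using assms(3) by (simp add: v_def)
  qed
  have u_sgn: "\<exists>k>0. u t = k * u 0" if t: "t \<ge> 0" for t
  proof -
    obtain k where "k > 0" "u t = k * u 0"
    proof (rule homogeneous_linear_ODE[of u R t])
      show "(u has_real_derivative R s * u s) (at s within {0..})" if "s \<ge> 0" for s
        using u'[OF that] v_0[OF that] by (simp add: mult.commute)
    qed (use contR t in auto)
    then show ?thesis by blast
  qed
  have u_nz: "u t \<noteq> 0" if "t \<ge> 0" for t
    using u_sgn[OF that] assms(4) by (auto simp: u_def)
  have u2: "1 / (u t)\<^sup>2 = 1 / (u 0)\<^sup>2 + 2 * (- c) * t" if "t \<ge> 0" for t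
  proof -
    have "((\<lambda>s. 1 / (u s)\<^sup>2) has_real_derivative - 2 * c) (at s within {0..})"
      if "s \<ge> 0" for s
      by (rule derivative_eq_intros u'[OF that] refl)+
        (use u_nz[OF that] v_0[OF that] in
          \<open>simp_all add: R_def chart_rate_def field_simps power2_eq_square\<close>)
    then have "((\<lambda>s. 2 * c * s + 1 / (u s)\<^sup>2) has_real_derivative 2 * c * 1 + - 2 * c) (at s within {0..})"
      if "s \<ge> 0" for s
      using that by (intro DERIV_add DERIV_cmult DERIV_ident)
    then have "((\<lambda>s. 2 * c * s + 1 / (u s)\<^sup>2) has_real_derivative 0) (at s within {0..})"
      if "s \<ge> 0" for s
      using that by simp
    then obtain C where C: "\<And>s. s \<ge> 0 \<Longrightarrow> 2 * c * s + 1 / (u s)\<^sup>2 = C"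
      using has_field_derivative_zero_constant[of "{0..}" "\<lambda>s. 2 * c * s + 1 / (u s)\<^sup>2"] by auto
    show ?thesis using C[of 0] C[OF that] by simp
  qed
  have "filterlim (\<lambda>t. 1 / (u 0)\<^sup>2 + 2 * (- c) * t) at_top at_top"
    using assms(1)
    by (intro filterlim_tendsto_add_at_top[OF tendsto_const]
        filterlim_tendsto_pos_mult_at_top[OF tendsto_const _ filterlim_ident]) simp
  then have "((\<lambda>t. 1 / (1 / (u 0)\<^sup>2 + 2 * (- c) * t)) \<longlongrightarrow> 0) at_top"
    by (intro tendsto_divide_0[OF tendsto_const] filterlim_at_top_imp_at_infinity)
  moreover have "\<forall>\<^sub>F t in at_top. 1 / (1 / (u 0)\<^sup>2 + 2 * (- c) * t) = (u t)\<^sup>2"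
    using eventually_ge_at_top[of 0]
  proof eventually_elim
    case (elim t)
    show ?case unfolding u2[OF elim, symmetric] by simp
  qed
  ultimately have "((\<lambda>t. (u t)\<^sup>2) \<longlongrightarrow> 0) at_top"
    by (rule Lim_transform_eventually)
  from tendsto_real_sqrt[OF this] have "(u \<longlongrightarrow> 0) at_top"
    by (simp add: tendsto_rabs_zero_iff)
  then have "((\<lambda>t. (u t, 0 :: real)) \<longlongrightarrow> (0, 0)) at_top"
    by (intro tendsto_intros)
  moreover have "\<forall>\<^sub>F t in at_top. (u t, 0) = x t"
    using eventually_ge_at_top[of 0]
    by eventually_elim (use v_0 in \<open>simp add: prod_eq_iff u_def v_def\<close>)
  ultimately have "(x \<longlongrightarrow> (0, 0)) at_top"
    by (rule Lim_transform_eventually)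
  moreover have "((\<lambda>t. sgn (x t - (0, 0))) \<longlongrightarrow> sgn (x 0)) at_top"
  proof (rule tendsto_eventually)
    show "\<forall>\<^sub>F t in at_top. sgn (x t - (0, 0)) = sgn (x 0)"
      using eventually_ge_at_top[of 0]
    proof eventually_elim
      case (elim t)
      then obtain k where "k > 0" "u t = k * u 0" using u_sgn by blast
      then have "x t - (0, 0) = k *\<^sub>R x 0"
        using v_0[OF elim] v_0[of 0] by (simp add: prod_eq_iff u_def v_def)
      then show ?case using \<open>k > 0\<close> by (simp add: sgn_scaleR)
    qed
  qed
  moreover have "norm (sgn (x 0)) = 1"
    using assms(4) by (auto simp: norm_sgn)
  ultimately show ?thesis unfolding tends_with_tangent_def by blast
qed

text \<open>Integrating \<open>u' = c * u ^ 3\<close> gives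
  \<open>u0 / sqrt (1 - 2 * c * u0\<^sup>2 * t)\<close>; the sign of \<open>c\<close> keeps the
  radicand positive for \<open>t \<ge> 0\<close>.\<close>

lemma chart_field_solution_axis:
  assumes "c < 0"
  obtains x where "solves_ode_on (chart_field b c d) {0..} x" "x 0 = (u0, 0)"
proof
  define D where "D t = 1 + 2 * (- c) * u0\<^sup>2 * t" for t
  have D_pos: "D t > 0" if "t \<ge> 0" for t
  proof -
    have "0 \<le> 2 * (- c) * u0\<^sup>2 * t" using assms that by (intro mult_nonneg_nonneg) auto
    then show ?thesis unfolding D_def by linarith
  qed
  have D': "(D has_real_derivative 2 * (- c) * u0\<^sup>2) (at t within {0..})" for t
    unfolding D_def by (auto intro!: derivative_eq_intros)
  show "solves_ode_on (chart_field b c d) {0..} (\<lambda>t. (u0 / sqrt (D t), 0))"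
    unfolding solves_chart_field_iff
  proof (intro ballI conjI, simp_all only: fst_conv snd_conv)
    fix t :: real assume "t \<in> {0..}"
    then have D: "D t > 0" using D_pos by simp
    define S where "S = sqrt (D t)"
    have S: "S > 0" "chart_rate b c d (u0 / S) 0 = c * u0\<^sup>2 / S\<^sup>2"
      using D by (simp_all add: S_def chart_rate_def power_divide)
    have sqrt': "((\<lambda>t. sqrt (D t)) has_real_derivative (inverse S / 2) * (2 * (- c) * u0\<^sup>2))
        (at t within {0..})"
      unfolding S_def by (rule DERIV_chain2[OF DERIV_real_sqrt[OF D] D'])
    have "((\<lambda>t. u0 / sqrt (D t)) has_real_derivative 0 + u0 / S * (c * u0\<^sup>2 / S\<^sup>2))
        (at t within {0..})"
      by (rule derivative_eq_intros sqrt' refl)+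
        (use S(1) in \<open>simp_all add: S_def[symmetric] field_simps power2_eq_square\<close>)
    then show "((\<lambda>t. u0 / sqrt (D t)) has_real_derivative
        0 + u0 / sqrt (D t) * chart_rate b c d (u0 / sqrt (D t)) 0) (at t within {0..})"
      by (simp only: S_def[symmetric] S(2))
  qed simp
  show "(u0 / sqrt (D 0), 0) = (u0, 0 :: real)" by (simp add: D_def)
qed

section \<open>Symmetries\<close>

lemma solves_ode_on_linear_image:
  assumes "bounded_linear \<sigma>" "solves_ode_on F T x" "\<And>z. H (\<sigma> z) = \<sigma> (F z)"
  shows "solves_ode_on H T (\<lambda>t. \<sigma> (x t))"
  using assms bounded_linear.has_vector_derivative[OF assms(1)]
  by (simp add: solves_ode_on_def)

lemma solves_ode_on_time_reversal:
  assumes "solves_ode_on F T x"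
  shows "solves_ode_on (\<lambda>z. - F z) (uminus ` T) (\<lambda>t. x (- t))"
  unfolding solves_ode_on_def
proof
  fix t assume t: "t \<in> uminus ` T"
  have "(uminus has_vector_derivative - 1) (at t within uminus ` T)"
    by (auto intro!: derivative_eq_intros)
  moreover have "(x has_vector_derivative F (x (- t))) (at (- t) within uminus ` uminus ` T)"
    using assms t by (auto simp: solves_ode_on_def image_image)
  ultimately show "((\<lambda>t. x (- t)) has_vector_derivative - F (x (- t))) (at t within uminus ` T)"
    using vector_diff_chain_within[of uminus "- 1" t "uminus ` T" x "F (x (- t))"]
    by (simp add: o_def)
qed

text \<open>An orthogonal map preserves the norm and therefore commutes with \<open>sgn\<close>, so
  it carries limiting directions to limiting directions.\<close>

lemma tends_with_tangent_orthogonal_image: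
  assumes \<sigma>: "orthogonal_transformation \<sigma>" and x: "tends_with_tangent x 0 L"
  shows "tends_with_tangent (\<lambda>t. \<sigma> (x t)) 0 L"
proof -
  have lin: "linear \<sigma>" using \<sigma> by (rule orthogonal_transformation_linear)
  then have bl: "bounded_linear \<sigma>" by (rule linear_conv_bounded_linear[THEN iffD1])
  have norm: "norm (\<sigma> z) = norm z" for z
    using \<sigma> by (rule orthogonal_transformation_norm)
  have sgn: "sgn (\<sigma> z) = \<sigma> (sgn z)" for z
    by (simp add: sgn_div_norm norm linear_scale[OF lin])
  obtain w where w: "norm w = 1" "((\<lambda>t. sgn (x t)) \<longlongrightarrow> w) L" and "(x \<longlongrightarrow> 0) L"
    using x by (auto simp: tends_with_tangent_def)
  have "norm (\<sigma> w) = 1" "((\<lambda>t. sgn (\<sigma> (x t) - 0)) \<longlongrightarrow> \<sigma> w) L"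
    using w(1) bounded_linear.tendsto[OF bl w(2)] by (simp_all add: norm sgn)
  moreover have "((\<lambda>t. \<sigma> (x t)) \<longlongrightarrow> 0) L"
    using bounded_linear.tendsto[OF bl \<open>(x \<longlongrightarrow> 0) L\<close>] by (simp add: linear_0[OF lin])
  ultimately show ?thesis unfolding tends_with_tangent_def by blast
qed

lemma tends_with_tangent_mirror:
  "tends_with_tangent x p at_bot \<longleftrightarrow> tends_with_tangent (\<lambda>t. x (- t)) p at_top"
  by (simp add: tends_with_tangent_def filterlim_at_bot_mirror)

text \<open>The passage from \<open>x t\<close> to \<open>\<sigma> (x (- t))\<close> turns forward
  solutions of \<open>F\<close> into backward solutions of \<open>H\<close>. It is its own inverse,
  and the isometry \<open>\<sigma>\<close> preserves the ball of initial points.\<close>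

lemma nearby_orbits_tend_reversible:
  assumes \<sigma>: "orthogonal_transformation \<sigma>" and inv: "\<And>z. \<sigma> (\<sigma> z) = z"
    and rev: "\<And>z. H (\<sigma> z) = - \<sigma> (F z)"
    and F: "nearby_orbits_tend F 0 {0..} at_top"
  shows "nearby_orbits_tend H 0 {..0} at_bot"
proof -
  have lin: "linear \<sigma>" using \<sigma> by (rule orthogonal_transformation_linear)
  then have bl: "bounded_linear \<sigma>" by (rule linear_conv_bounded_linear[THEN iffD1])
  have norm: "norm (\<sigma> z) = norm z" for z
    using \<sigma> by (rule orthogonal_transformation_norm)
  obtain \<delta> where "\<delta> > 0" and \<delta>: "\<And>q. q \<noteq> 0 \<Longrightarrow> norm q < \<delta> \<Longrightarrow>
      (\<exists>x. solves_ode_on F {0..} x \<and> x 0 = q) \<and>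
      (\<forall>x. solves_ode_on F {0..} x \<and> x 0 = q \<longrightarrow> tends_with_tangent x 0 at_top)"
    using F by (auto simp: nearby_orbits_tend_def)
  have "(\<exists>x. solves_ode_on H {..0} x \<and> x 0 = q) \<and>
      (\<forall>x. solves_ode_on H {..0} x \<and> x 0 = q \<longrightarrow> tends_with_tangent x 0 at_bot)"
    if "q \<noteq> 0" "norm q < \<delta>" for q
  proof (intro conjI allI impI; (elim conjE)?)
    have q: "\<sigma> q \<noteq> 0" "norm (\<sigma> q) < \<delta>"
      using that norm[of q] by auto
    from \<delta>[OF q] obtain x where x: "solves_ode_on F {0..} x" "x 0 = \<sigma> q"
      by blast
    have "solves_ode_on (\<lambda>z. - H z) {0..} (\<lambda>t. \<sigma> (x t))"
      by (rule solves_ode_on_linear_image[OF bl x(1)]) (simp add: rev)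
    from solves_ode_on_time_reversal[OF this]
    have "solves_ode_on H {..0} (\<lambda>t. \<sigma> (x (- t)))" by simp
    then show "\<exists>x. solves_ode_on H {..0} x \<and> x 0 = q"
      using x(2) inv by (intro exI[of _ "\<lambda>t. \<sigma> (x (- t))"]) simp
    fix y assume y: "solves_ode_on H {..0} y" "y 0 = q"
    have "solves_ode_on (\<lambda>z. - H z) {0..} (\<lambda>t. y (- t))"
      using solves_ode_on_time_reversal[OF y(1)] by simp
    then have "solves_ode_on F {0..} (\<lambda>t. \<sigma> (y (- t)))"
    proof (rule solves_ode_on_linear_image[OF bl])
      show "F (\<sigma> z) = \<sigma> (- H z)" for z
        using rev[of "\<sigma> z"] by (simp add: inv linear_neg[OF lin])
    qed
    with \<delta>[OF q] y(2) have "tends_with_tangent (\<lambda>t. \<sigma> (y (- t))) 0 at_top" by simp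
    from tends_with_tangent_orthogonal_image[OF \<sigma> this]
    show "tends_with_tangent y 0 at_bot"
      by (simp add: inv tends_with_tangent_mirror)
  qed
  then show ?thesis
    using \<open>\<delta> > 0\<close> by (auto simp: nearby_orbits_tend_def)
qed

text \<open>The central symmetry carries the half-plane \<open>v < 0\<close> to \<open>v > 0\<close>
  at the price of the sign of \<open>d\<close>, which is arbitrary in the results for
  \<open>v > 0\<close>.\<close>

lemma chart_field_neg: "chart_field b c (- d) (- z) = - chart_field b c d z"
  by (cases z) (simp add: chart_field_def chart_rate_def)

text \<open>Reflection in the \<open>u\<close>-axis together with time reversal exchanges
  \<open>c\<close> and \<open>- c\<close> and keeps \<open>b\<close> and \<open>d\<close>; this
  reduces the unstable case to the stable one.\<close>

lemma chart_field_reflect: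
  "chart_field b c d (fst z, - snd z) =
    - (fst (chart_field b (- c) d z), - snd (chart_field b (- c) d z))"
  by (cases z) (simp add: chart_field_def chart_rate_def algebra_simps)

lemma nearby_orbits_tend_chart_field:
  assumes "c < 0"
  shows "nearby_orbits_tend (chart_field b c d) 0 {0..} at_top"
proof -
  obtain \<delta>1 where "\<delta>1 > 0" and \<delta>1: "\<And>u v. \<bar>u\<bar> \<le> \<delta>1 \<Longrightarrow> 0 < v \<Longrightarrow> v \<le> \<delta>1 \<Longrightarrow>
      \<exists>x. solves_ode_on (chart_field b c d) {0..} x \<and> x 0 = (u, v)"
    by (rule chart_field_solution_upper[OF assms]) blast
  \<comment> \<open>The radius for \<open>- d\<close> serves initial points with
    \<open>v < 0\<close>, whose orbits are central reflections of orbits in the upper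
    half-plane.\<close>
  obtain \<delta>2 where "\<delta>2 > 0" and \<delta>2: "\<And>u v. \<bar>u\<bar> \<le> \<delta>2 \<Longrightarrow> 0 < v \<Longrightarrow> v \<le> \<delta>2 \<Longrightarrow>
      \<exists>x. solves_ode_on (chart_field b c (- d)) {0..} x \<and> x 0 = (u, v)"
    by (rule chart_field_solution_upper[OF assms]) blast
  have neg: "solves_ode_on (chart_field b c (- e)) {0..} (\<lambda>t. - x t)"
    if "solves_ode_on (chart_field b c e) {0..} x" for e x
    by (rule solves_ode_on_linear_image[OF bounded_linear_minus[OF bounded_linear_ident] that])
      (rule chart_field_neg)
  have "(\<exists>x. solves_ode_on (chart_field b c d) {0..} x \<and> x 0 = z) \<and>
      (\<forall>x. solves_ode_on (chart_field b c d) {0..} x \<and> x 0 = z \<longrightarrow> tends_with_tangent x 0 at_top)"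
    if "z \<noteq> 0" "norm z < min \<delta>1 \<delta>2" for z
  proof -
    obtain u v where z: "z = (u, v)" by (cases z)
    have uv: "\<bar>u\<bar> < min \<delta>1 \<delta>2" "\<bar>v\<bar> < min \<delta>1 \<delta>2"
      using that(2) norm_fst_le[of u v] norm_snd_le[of v u] by (auto simp: z)
    consider "v > 0" | "v < 0" | "v = 0" by linarith
    then show ?thesis
    proof cases
      case 1
      have "\<exists>x. solves_ode_on (chart_field b c d) {0..} x \<and> x 0 = z"
        unfolding z using uv 1 by (intro \<delta>1) auto
      moreover have "tends_with_tangent x 0 at_top"
        if "solves_ode_on (chart_field b c d) {0..} x" "x 0 = z" for x
        using chart_field_tends_upper[OF assms that(1)] that(2) 1 by (simp add: z zero_prod_def)
      ultimately show ?thesis by blast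
    next
      case 2
      have "\<bar>- u\<bar> \<le> \<delta>2" "0 < - v" "- v \<le> \<delta>2" using uv 2 by auto
      from \<delta>2[OF this] obtain x
        where x: "solves_ode_on (chart_field b c (- d)) {0..} x" "x 0 = (- u, - v)"
        by blast
      have "solves_ode_on (chart_field b c d) {0..} (\<lambda>t. - x t) \<and> - x 0 = z"
        using neg[OF x(1)] x(2) by (simp add: z)
      moreover have "tends_with_tangent y 0 at_top"
        if y: "solves_ode_on (chart_field b c d) {0..} y" "y 0 = z" for y
      proof -
        have "tends_with_tangent (\<lambda>t. - y t) 0 at_top"
          using chart_field_tends_upper[OF assms neg[OF y(1)]] y(2) 2
          by (simp add: z zero_prod_def)
        from tends_with_tangent_orthogonal_image[of uminus, OF _ this]
        show ?thesis by (simp add: orthogonal_transformation_neg[of "\<lambda>x. x"])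
      qed
      ultimately show ?thesis by blast
    next
      case 3
      with that(1) have "u \<noteq> 0" by (auto simp: z zero_prod_def)
      have "\<exists>x. solves_ode_on (chart_field b c d) {0..} x \<and> x 0 = z"
        unfolding z 3 by (rule chart_field_solution_axis[OF assms]) blast
      moreover have "tends_with_tangent x 0 at_top"
        if "solves_ode_on (chart_field b c d) {0..} x" "x 0 = z" for x
        using chart_field_tends_axis[OF assms that(1)] that(2) 3 \<open>u \<noteq> 0\<close>
        by (simp add: z zero_prod_def)
      ultimately show ?thesis by blast
    qed
  qed
  then show ?thesis
    using \<open>\<delta>1 > 0\<close> \<open>\<delta>2 > 0\<close> unfolding nearby_orbits_tend_def
    by (intro exI[of _ "min \<delta>1 \<delta>2"]) auto
qed

section \<open>The node\<close>

text \<open>If \<open>v \<noteq> 0\<close>, the second component forces the rate to vanish, and then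
  the first one equals \<open>v\<close>. If \<open>v = 0\<close>, what remains is
  \<open>c * u ^ 3 = 0\<close>.\<close>

lemma chart_field_eq_0_iff:
  assumes "c \<noteq> 0"
  shows "chart_field b c d z = 0 \<longleftrightarrow> z = 0"
proof (cases z)
  case (Pair u v)
  have "v = 0 \<and> u = 0" if "v + u * chart_rate b c d u v = 0" "v * chart_rate b c d u v = 0"
    using that assms by (cases "v = 0") (auto simp: chart_rate_def)
  then show ?thesis
    by (auto simp: Pair chart_field_def zero_prod_def)
qed

lemma zero_isolated_in_zeros_chart_field:
  assumes "c \<noteq> 0"
  shows "0 isolated_in {z. chart_field b c d z = 0}"
  unfolding isolated_in_def
  using chart_field_eq_0_iff[OF assms] by (auto intro!: exI[of _ UNIV])

text \<open>The degree fixes the power of \<open>v\<close> by which the chart expression is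
  multiplied.\<close>

lemma vf_degree_quadratic:
  fixes b c d :: real
  assumes "c \<noteq> 0"
  shows "vf_degree (\<lambda>(x, y). (y, d * y - b * x - c * x\<^sup>2)) = 2"
  unfolding vf_degree_def
proof (rule Least_equality)
  have "poly_fun_deg_le 2 (\<lambda>z. snd z)"
    unfolding poly_fun_deg_le_def
    by (rule exI[of _ "\<lambda>i j. if i = 0 \<and> j = 1 then 1 else 0"]) (simp add: eval_nat_numeral)
  moreover have "poly_fun_deg_le 2 (\<lambda>z. d * snd z - b * fst z - c * (fst z)\<^sup>2)"
    unfolding poly_fun_deg_le_def
    by (rule exI[of _ "\<lambda>i j. if i = 0 \<and> j = 1 then d else if i = 1 \<and> j = 0 then - b
        else if i = 2 \<and> j = 0 then - c else 0"]) (simp add: eval_nat_numeral)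
  ultimately show "poly_fun_deg_le 2 (\<lambda>z. fst (case z of (x, y) \<Rightarrow> (y, d * y - b * x - c * x\<^sup>2))) \<and>
      poly_fun_deg_le 2 (\<lambda>z. snd (case z of (x, y) \<Rightarrow> (y, d * y - b * x - c * x\<^sup>2)))"
    by (simp add: case_prod_beta)
  fix n
  assume "poly_fun_deg_le n (\<lambda>z. fst (case z of (x, y) \<Rightarrow> (y, d * y - b * x - c * x\<^sup>2))) \<and>
      poly_fun_deg_le n (\<lambda>z. snd (case z of (x, y) \<Rightarrow> (y, d * y - b * x - c * x\<^sup>2)))"
  then obtain a where a: "\<And>x y. d * y - b * x - c * x\<^sup>2 = (\<Sum>i\<le>n. \<Sum>j\<le>n - i. a i j * x ^ i * y ^ j)"
    by (auto simp: poly_fun_deg_le_def)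
  show "2 \<le> n"
  proof (rule ccontr)
    assume "\<not> 2 \<le> n"
    then have "n = 0 \<or> n = 1" by linarith
    then show False
      \<comment> \<open>A polynomial of degree at most \<open>1\<close> is affine along
        \<open>y = 0\<close>, so its second difference at \<open>- 1, 0, 1\<close> vanishes; here
        that difference is \<open>- 2 * c\<close>.\<close>
      using a[where x = 1 and y = 0] a[where x = "- 1" and y = 0] a[where x = 0 and y = 0] assms
      by auto
  qed
qed

lemma polynomial_function_Pair:
  assumes "real_polynomial_function f" "real_polynomial_function g"
  shows "polynomial_function (\<lambda>z. (f z, g z))"
proof -
  have "polynomial_function (\<lambda>z. f z *\<^sub>R (1 :: real, 0 :: real) + g z *\<^sub>R (0, 1))"
    using assms
    by (intro polynomial_function_add polynomial_function_mult polynomial_function_const)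
      (simp_all add: real_polynomial_function_eq)
  then show ?thesis by simp
qed

theorem proposition6p5:
  fixes b c d :: real and s :: nat
    and X G :: "real \<times> real \<Rightarrow> real \<times> real"
  assumes "b \<noteq> 0" and "c \<noteq> 0" and "d = b * (real s + 4)"
    and "X = (\<lambda>(x, y). (y, d / 2 * y - 3 / 2 * b * x - c * x\<^sup>2))"
    and "G = (\<lambda>(u, v). (v - d * u * v / 2 + 3 / 2 * b * u\<^sup>2 * v + c * u ^ 3,
                        - (d * v\<^sup>2 / 2) + 3 / 2 * b * u * v\<^sup>2 + c * u\<^sup>2 * v))"
  shows "U2_expression X G \<and>
         (c < 0 \<longrightarrow> stable_node G (0, 0)) \<and>
         (c > 0 \<longrightarrow> unstable_node G (0, 0))"
proof -
  have proj: "real_polynomial_function (fst :: real \<times> real \<Rightarrow> real)"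
    "real_polynomial_function (snd :: real \<times> real \<Rightarrow> real)"
    by (simp_all add: real_polynomial_function.intros(1) bounded_linear_fst bounded_linear_snd)
  note polynomial_intros = polynomial_function_Pair proj
    real_polynomial_function.intros(2-4) real_polynomial_function_diff
    real_polynomial_function_minus real_polynomial_function_power real_polynomial_function_divide
  have "polynomial_function X"
    unfolding assms(4) case_prod_beta by (intro polynomial_intros)
  moreover have "polynomial_function G"
    unfolding assms(5) case_prod_beta by (intro polynomial_intros)
  moreover have "vf_degree X = 2"
    unfolding assms(4) using assms(2) by (rule vf_degree_quadratic)
  ultimately have "U2_expression X G"
    by (auto simp: U2_expression_def assms(4,5) Let_def field_simps power2_eq_square power3_eq_cube)
  moreover have G: "G = chart_field b c d"
    unfolding assms(5) chart_field_def chart_rate_def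
    by (auto simp: fun_eq_iff algebra_simps power2_eq_square power3_eq_cube)
  have "stable_node G (0, 0)" if "c < 0"
    using zero_isolated_in_zeros_chart_field[OF assms(2)] nearby_orbits_tend_chart_field[OF that]
    by (simp add: stable_node_def G zero_prod_def)
  moreover have "unstable_node G (0, 0)" if "c > 0"
  proof -
    define \<sigma> :: "real \<times> real \<Rightarrow> real \<times> real" where "\<sigma> z = (fst z, - snd z)" for z
    have "nearby_orbits_tend G 0 {..0} at_bot"
    proof (rule nearby_orbits_tend_reversible)
      show "orthogonal_transformation \<sigma>"
        by (auto simp: orthogonal_transformation_def \<sigma>_def inner_prod_def intro!: linearI)
      show "\<sigma> (\<sigma> z) = z" for z by (simp add: \<sigma>_def)
      show "G (\<sigma> z) = - \<sigma> (chart_field b (- c) d z)" for z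
        by (simp add: G \<sigma>_def chart_field_reflect)
      show "nearby_orbits_tend (chart_field b (- c) d) 0 {0..} at_top"
        using that by (intro nearby_orbits_tend_chart_field) simp
    qed
    then show ?thesis
      using zero_isolated_in_zeros_chart_field[OF assms(2)]
      by (simp add: unstable_node_def G zero_prod_def)
  qed
  ultimately show ?thesis by blast
qed

end
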